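(* Let $d,\nu\ge 1$ be integers, let $F_1,\ldots,F_d:\mathbb{R}^\nu\to\mathbb{R}$ be almost periodic functions of $\nu$ variables, and let $P_{i,j}$ ($1\le i\le d$, $1\le j\le\nu$) and $P_1,\ldots,P_d$ be real polynomials in one variable without constant term. If $P_1,\ldots,P_d$ are $\mathbf{Q}$-independent, then the sequence of vectors $$\Bigl(P_1(n)+F_1\bigl(P_{1,1}(n),\ldots,P_{1,\nu}(n)\bigr),\ \ldots,\ P_d(n)+F_d\bigl(P_{d,1}(n),\ldots,P_{d,\nu}(n)\bigr)\Bigr),\qquad n=1,2,\ldots,$$ is dense in $[0,1)^d$ (mod 1).
   Context: A sequence of vectors in $\mathbb{R}^d$ is dense in $[0,1)^d$ (mod 1) if the set of vectors obtained by taking fractional parts coordinatewise is dense in $[0,1)^d$. An almost periodic function of $\nu$ variables is a function $\mathbb{R}^\nu\to\mathbb{R}$ belonging to the closure, in the uniform norm on $\mathbb{R}^\nu$, of the real algebra generated by the functions $\cos(\lambda x_j)$, $\sin(\lambda x_j)$, $\lambda\in\mathbb{R}$, $1\le j\le\nu$. Real polynomials $P_1,\ldots,P_d$ without constant term are called $\mathbf{Q}$-independent if no linear combination $r_1P_1+\cdots+r_dP_d$ with rational $r_1,\ldots,r_d$, not all zero, is a polynomial with rational coefficients. *)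

theory Defs
  imports "HOL-Analysis.Analysis" "HOL-Computational_Algebra.Polynomial"
begin

text \<open>The real algebra generated by \<open>cos (\<lambda> x\<^sub>j)\<close> and \<open>sin (\<lambda> x\<^sub>j)\<close>; it contains the
  constants because \<open>\<lambda> = 0\<close> is allowed.\<close>

inductive_set trig_algebra :: "(real ^ 'n \<Rightarrow> real) set" where
  cos: "(\<lambda>x. cos (l * x $ j)) \<in> trig_algebra"
| sin: "(\<lambda>x. sin (l * x $ j)) \<in> trig_algebra"
| add: "f \<in> trig_algebra \<Longrightarrow> g \<in> trig_algebra \<Longrightarrow> (\<lambda>x. f x + g x) \<in> trig_algebra"
| mult: "f \<in> trig_algebra \<Longrightarrow> g \<in> trig_algebra \<Longrightarrow> (\<lambda>x. f x * g x) \<in> trig_algebra"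
| scale: "f \<in> trig_algebra \<Longrightarrow> (\<lambda>x. c * f x) \<in> trig_algebra"

definition almost_periodic :: "(real ^ 'n \<Rightarrow> real) \<Rightarrow> bool" where
  "almost_periodic F \<longleftrightarrow> (\<forall>e>0. \<exists>f\<in>trig_algebra. \<forall>x. \<bar>F x - f x\<bar> < e)"

definition Q_independent :: "('d::finite \<Rightarrow> real poly) \<Rightarrow> bool" where
  "Q_independent P \<longleftrightarrow>
     (\<forall>r :: 'd \<Rightarrow> rat. (\<exists>i. r i \<noteq> 0) \<longrightarrow>
        \<not> (\<forall>k. coeff (\<Sum>i\<in>UNIV. smult (of_rat (r i)) (P i)) k \<in> \<rat>))"

text \<open>The sequence is \<open>a 1, a 2, \<dots>\<close>; the value \<open>a 0\<close> is ignored.\<close>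

definition dense_mod1 :: "(nat \<Rightarrow> real ^ 'd) \<Rightarrow> bool" where
  "dense_mod1 a \<longleftrightarrow>
     {x. \<forall>i. 0 \<le> x $ i \<and> x $ i < 1} \<subseteq> closure ((\<lambda>n. \<chi> i. frac (a n $ i)) ` {1..})"

end

theory Submission
  imports Defs
begin

text \<open>
  After a uniform approximation each \<open>F\<^sub>i (P\<^sub>i\<^sub>,\<^sub>1 n, \<dots>)\<close> becomes a function \<open>h\<^sub>i\<close> of finitely many
  angles \<open>l P\<^sub>i\<^sub>,\<^sub>j n\<close> modulo \<open>2 \<pi>\<close>. By \<open>\<rat>\<close>-independence there are additive functionals \<open>\<phi>\<^sub>m\<close> on
  \<open>\<real>[X]\<close> that vanish on \<open>\<rat>[X]\<close> and are dual to \<open>P\<^sub>1, \<dots>, P\<^sub>d\<close>. For a vector \<open>u\<close> the functional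
  \<open>\<psi>\<^sub>u = \<Sum> u\<^sub>m \<phi>\<^sub>m\<close> respects all integer relations modulo \<open>\<rat>[X]\<close>, so by Weyl's theorem on
  exponential sums there are \<open>n\<close> for which every one of finitely many polynomials \<open>W\<close> satisfies
  \<open>W n \<approx> \<psi>\<^sub>u W\<close> modulo 1; in particular \<open>P\<^sub>i n \<approx> u\<^sub>i\<close>. It remains to choose \<open>u\<close> such that
  \<open>u\<^sub>i + h\<^sub>i (2 \<pi> \<psi>\<^sub>u (l P\<^sub>i\<^sub>,\<^sub>j / 2 \<pi>)) = y\<^sub>i\<close> for the given target \<open>y\<close>. As \<open>h\<close> is bounded and
  continuous, Brouwer's fixed point theorem provides such a \<open>u\<close>.
\<close>

subsection \<open>Weyl sums\<close>

definition mean :: "(nat \<Rightarrow> complex) \<Rightarrow> nat \<Rightarrow> complex" where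
  "mean f N = (\<Sum>n<N. f n) / of_nat N"

lemma mean_sum: "mean (\<lambda>n. \<Sum>a\<in>A. f a n) N = (\<Sum>a\<in>A. mean (f a) N)"
  unfolding mean_def by (subst sum.swap) (simp add: sum_divide_distrib)

lemma mean_cmult: "mean (\<lambda>n. c * f n) N = c * mean f N"
  unfolding mean_def by (simp add: sum_distrib_left)

lemma norm_mean_le:
  assumes "\<And>n. norm (f n) \<le> b" "b \<ge> 0"
  shows "norm (mean f N) \<le> b"
proof -
  have "norm (\<Sum>n<N. f n) \<le> of_nat (card {..<N}) * b"
    by (rule sum_norm_bound) (use assms in auto)
  then show ?thesis
    using assms(2) by (cases "N = 0") (auto simp: mean_def norm_divide field_simps)
qed

lemma mean_const: "(mean (\<lambda>_. c)) \<longlonglongrightarrow> c"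
proof -
  have "\<forall>\<^sub>F N in sequentially. c = mean (\<lambda>_. c) N"
    using eventually_gt_at_top[of 0] by eventually_elim (auto simp: mean_def)
  then show ?thesis by (rule Lim_transform_eventually[OF tendsto_const])
qed

text \<open>The two sums differ only in \<open>h\<close> terms at either end, so the means differ by
  at most \<open>2 h / N\<close>.\<close>

lemma mean_shift_diff:
  assumes "\<And>n. norm (f n) \<le> 1"
  shows "(\<lambda>N. mean (\<lambda>n. f (n + h)) N - mean f N) \<longlonglongrightarrow> 0"
proof (rule Lim_null_comparison)
  show "(\<lambda>N. 2 * real h * (1 / real N)) \<longlonglongrightarrow> 0"
    using tendsto_mult_right_zero[OF lim_1_over_n[where 'a=real]] by simp
  have "norm (mean (\<lambda>n. f (n + h)) N - mean f N) \<le> 2 * real h * (1 / real N)" for N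
  proof -
    have "(\<Sum>n<N. f (n + h)) + (\<Sum>n<h. f n) = (\<Sum>n<N + h. f n)"
      by (induction N) (auto simp: algebra_simps)
    also have "\<dots> = (\<Sum>n<N. f n) + (\<Sum>n<h. f (N + n))"
      by (induction h) auto
    finally have "(\<Sum>n<N. f (n + h)) - (\<Sum>n<N. f n) = (\<Sum>n<h. f (N + n) - f n)"
      by (simp add: sum_subtractf algebra_simps)
    moreover have "norm (f (N + n) - f n) \<le> 2" for n
      using norm_triangle_ineq4[of "f (N + n)" "f n"] assms[of "N + n"] assms[of n] by linarith
    then have "norm (\<Sum>n<h. f (N + n) - f n) \<le> of_nat (card {..<h}) * 2"
      by (intro sum_norm_bound)
    ultimately show ?thesis
      by (simp add: mean_def norm_divide divide_right_mono mult.commute flip: diff_divide_distrib)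
  qed
  then show "\<forall>\<^sub>F N in sequentially. norm (mean (\<lambda>n. f (n + h)) N - mean f N) \<le> 2 * real h * (1 / real N)"
    by simp
qed

lemma mean_shift:
  assumes "\<And>n. norm (f n) \<le> 1" "mean f \<longlonglongrightarrow> c"
  shows "mean (\<lambda>n. f (n + h)) \<longlonglongrightarrow> c"
  using tendsto_add[OF mean_shift_diff[of f h, OF assms(1)] assms(2)] by simp

text \<open>Cauchy-Schwarz. The square is kept as \<open>f n * cnj (f n)\<close> so that it can be
  expanded into correlations.\<close>

lemma norm_mean_square_le:
  "(norm (mean f N))\<^sup>2 \<le> Re (mean (\<lambda>n. f n * cnj (f n)) N)"
proof -
  have "(norm (\<Sum>n<N. f n))\<^sup>2 \<le> (\<Sum>n<N. norm (f n))\<^sup>2"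
    by (intro power_mono norm_sum) auto
  also have "\<dots> \<le> real N * (\<Sum>n<N. (norm (f n))\<^sup>2)"
    using sum_squared_le_sum_of_squares[of "\<lambda>n. norm (f n)" "{..<N}"] by (simp add: mult.commute)
  finally have *: "(norm (\<Sum>n<N. f n))\<^sup>2 \<le> real N * (\<Sum>n<N. (norm (f n))\<^sup>2)" .
  have "Re (mean (\<lambda>n. f n * cnj (f n)) N) = (\<Sum>n<N. (norm (f n))\<^sup>2) / real N"
    by (simp add: mean_def complex_norm_square[symmetric] flip: of_real_sum of_real_power)
  then show ?thesis using *
    by (cases "N = 0") (auto simp: mean_def norm_divide field_simps power2_eq_square)
qed

text \<open>Averaging \<open>u\<close> over \<open>H\<close> consecutive translates does not affect
  the limiting behaviour of the mean. By Cauchy-Schwarz the squared mean of the averaged sequence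
  \<open>v\<close> is at most the mean of its squared modulus; there the correlations vanish in the
  limit, and the \<open>H\<close> diagonal terms out of \<open>H\<close>\<times>\<open>H\<close>
  leave \<open>1 / H\<close>.\<close>

lemma van_der_Corput:
  assumes norm_u: "\<And>n. norm (u n) = 1"
    and corr: "\<And>h. h > 0 \<Longrightarrow> mean (\<lambda>n. u (n + h) * cnj (u n)) \<longlonglongrightarrow> 0"
  shows "mean u \<longlonglongrightarrow> 0"
proof -
  \<comment> \<open>A common shift reduces \<open>b < a\<close> to the hypothesis with lag
    \<open>a - b\<close>; conjugation gives \<open>a < b\<close>.\<close>
  have corr': "mean (\<lambda>n. u (n + a) * cnj (u (n + b))) \<longlonglongrightarrow> (if a = b then 1 else 0)" for a b
  proof -
    have less: "mean (\<lambda>n. u (n + a) * cnj (u (n + b))) \<longlonglongrightarrow> 0" if "b < a" for a b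
      using mean_shift[OF _ corr[of "a - b"], of b] that norm_u by (simp add: norm_mult add.assoc)
    consider "a = b" | "b < a" | "a < b" by linarith
    then show ?thesis
    proof cases
      case 1
      then show ?thesis using mean_const[of 1] norm_u
        by (simp add: complex_norm_square[symmetric])
    next
      case 2
      then show ?thesis using less by simp
    next
      case 3
      have "(\<lambda>N. cnj (mean (\<lambda>n. u (n + b) * cnj (u (n + a))) N)) \<longlonglongrightarrow> cnj 0"
        by (intro tendsto_cnj less 3)
      also have "(\<lambda>N. cnj (mean (\<lambda>n. u (n + b) * cnj (u (n + a))) N)) = mean (\<lambda>n. u (n + a) * cnj (u (n + b)))"
        by (simp add: mean_def fun_eq_iff mult.commute)
      finally show ?thesis using 3 by simp
    qed
  qed
  have bound: "\<forall>\<^sub>F N in sequentially. norm (mean u N) < e" if e: "e > 0" for e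
  proof -
    obtain H where H: "real H > 0" "1 / real H < (e / 2)\<^sup>2"
    proof -
      obtain H where "1 / real (Suc H) < (e / 2)\<^sup>2"
        using nat_approx_posE[of "(e/2)\<^sup>2"] e by auto
      then show ?thesis using that[of "Suc H"] by simp
    qed
    define v where "v = (\<lambda>n. (1 / of_nat H) * (\<Sum>h<H. u (n + h)))"
    have vv: "v n * cnj (v n) = (1 / of_nat H)\<^sup>2 * (\<Sum>a<H. \<Sum>b<H. u (n + a) * cnj (u (n + b)))" for n
      by (simp add: v_def power2_eq_square sum_product)
    have "(\<lambda>N. (1 / of_nat H)\<^sup>2 * (\<Sum>a<H. \<Sum>b<H. mean (\<lambda>n. u (n + a) * cnj (u (n + b))) N))
        \<longlonglongrightarrow> (1 / of_nat H)\<^sup>2 * (\<Sum>a<H. \<Sum>b<H. (if a = b then 1 else 0))"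
      by (intro tendsto_intros corr')
    also have "(1 / of_nat H)\<^sup>2 * (\<Sum>a<H. \<Sum>b<H. (if a = b then 1 else 0)) = (of_real (1 / real H) :: complex)"
      using H(1) by (simp add: power2_eq_square)
    finally have "(\<lambda>N. mean (\<lambda>n. v n * cnj (v n)) N) \<longlonglongrightarrow> of_real (1 / real H)"
      by (simp only: vv mean_cmult mean_sum)
    then have "(\<lambda>N. Re (mean (\<lambda>n. v n * cnj (v n)) N)) \<longlonglongrightarrow> 1 / real H"
      by (auto dest: tendsto_Re)
    then have ev1: "\<forall>\<^sub>F N in sequentially. Re (mean (\<lambda>n. v n * cnj (v n)) N) < (e / 2)\<^sup>2"
      using H(2) order_tendstoD(2) by blast
    have "(\<lambda>N. (1 / of_nat H) * (\<Sum>h<H. mean (\<lambda>n. u (n + h)) N - mean u N)) \<longlonglongrightarrow> (1 / of_nat H) * (\<Sum>h<H. 0)"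
      by (intro tendsto_intros mean_shift_diff) (simp add: norm_u)
    moreover have "(1 / of_nat H) * (\<Sum>h<H. mean (\<lambda>n. u (n + h)) N - mean u N) = mean v N - mean u N" for N
    proof -
      have "mean v N = (1 / of_nat H) * (\<Sum>h<H. mean (\<lambda>n. u (n + h)) N)"
        by (simp only: v_def mean_cmult mean_sum)
      then show ?thesis using H(1) by (simp add: sum_subtractf diff_divide_distrib)
    qed
    ultimately have "(\<lambda>N. mean v N - mean u N) \<longlonglongrightarrow> 0" by simp
    then have ev2: "\<forall>\<^sub>F N in sequentially. norm (mean v N - mean u N) < e / 2"
      using e by (auto dest: tendstoD[of _ _ _ "e/2"] simp: dist_norm)
    from ev1 ev2 show ?thesis
    proof eventually_elim
      case (elim N)
      have "(norm (mean v N))\<^sup>2 < (e / 2)\<^sup>2"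
        using norm_mean_square_le[of v N] elim(1) by linarith
      then have "norm (mean v N) < e / 2"
        by (rule power_less_imp_less_base) (use e in simp)
      moreover have "norm (mean u N) \<le> norm (mean v N) + norm (mean v N - mean u N)"
        by (metis norm_triangle_sub norm_minus_commute)
      ultimately show ?case using elim(2) by linarith
    qed
  qed
  then show ?thesis by (auto simp: tendsto_iff dist_norm)
qed

section \<open>Weyl differencing of polynomials\<close>

lemma pcompose_power: "pcompose (p ^ n) q = pcompose p q ^ n" for p q :: "'a::comm_semiring_1 poly"
  by (induction n) (simp_all add: pcompose_mult pcompose_1)

lemma coeff_pcompose_shift:
  fixes p :: "'a::comm_ring_1 poly"
  shows "coeff (pcompose p [:h, 1:]) m = (\<Sum>i=m..degree p. coeff p i * of_nat (i choose m) * h ^ (i - m))"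
proof -
  have "coeff (pcompose p [:h, 1:]) m = (\<Sum>i\<le>degree p. coeff p i * coeff ([:h, 1:] ^ i) m)"
    by (subst poly_as_sum_of_monoms[of p, symmetric]) (simp add: pcompose_sum coeff_sum monom_altdef pcompose_smult pcompose_power pcompose_pCons)
  also have "\<dots> = (\<Sum>i=m..degree p. coeff p i * coeff ([:h, 1:] ^ i) m)"
  proof (rule sum.mono_neutral_right)
    show "\<forall>i\<in>{..degree p} - {m..degree p}. coeff p i * coeff ([:h, 1:] ^ i) m = 0"
    proof
      fix i assume "i \<in> {..degree p} - {m..degree p}"
      then have "degree ([:h, 1:] ^ i) < m"
        using degree_power_le[of "[:h, 1:]" i] by (auto simp: degree_pCons_eq_if split: if_splits)
      then show "coeff p i * coeff ([:h, 1:] ^ i) m = 0" by (simp add: coeff_eq_0)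
    qed
  qed auto
  also have "\<dots> = (\<Sum>i=m..degree p. coeff p i * of_nat (i choose m) * h ^ (i - m))"
    by (intro sum.cong) (auto simp: coeff_linear_poly_power mult.assoc)
  finally show ?thesis .
qed

lemma coeff_difference:
  fixes p :: "'a::comm_ring_1 poly"
  shows "coeff (pcompose p [:h, 1:] - p) m
    = (\<Sum>i=Suc m..degree p. coeff p i * of_nat (i choose m) * h ^ (i - m))"
proof (cases "m \<le> degree p")
  case True
  then show ?thesis by (simp add: coeff_pcompose_shift sum.atLeast_Suc_atMost)
next
  case False
  then show ?thesis by (simp add: coeff_pcompose_shift coeff_eq_0)
qed

text \<open>The new coefficient at \<open>k\<close> is \<open>(k + 1) h\<close> times the old one at
  \<open>k + 1\<close>, plus a rational number built from higher coefficients. So differencing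
  lowers the position of the topmost irrational coefficient by exactly one.\<close>

lemma irrational_coeff_difference:
  fixes p :: "real poly"
  assumes irr: "coeff p (Suc k) \<notin> \<rat>" and rat: "\<And>j. j > Suc k \<Longrightarrow> coeff p j \<in> \<rat>" and "h > 0"
  shows "coeff (pcompose p [:of_nat h, 1:] - p) k \<notin> \<rat>"
    and "j > k \<Longrightarrow> coeff (pcompose p [:of_nat h, 1:] - p) j \<in> \<rat>"
proof -
  have le: "Suc k \<le> degree p"
    using irr by (metis Rats_0 le_degree)
  then have *: "coeff (pcompose p [:of_nat h, 1:] - p) k = coeff p (Suc k) * (real (Suc k) * real h)
      + (\<Sum>i=Suc (Suc k)..degree p. coeff p i * of_nat (i choose k) * of_nat h ^ (i - k))" (is "_ = _ + ?R")
    unfolding coeff_difference by (subst sum.atLeast_Suc_atMost[OF le]) simp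
  have R: "?R \<in> \<rat>"
    using rat by (intro Rats_sum Rats_mult Rats_power) auto
  show "coeff (pcompose p [:of_nat h, 1:] - p) k \<notin> \<rat>"
  proof
    assume "coeff (pcompose p [:of_nat h, 1:] - p) k \<in> \<rat>"
    then have "coeff p (Suc k) * (real (Suc k) * real h) + ?R - ?R \<in> \<rat>"
      unfolding * using R by (rule Rats_diff)
    then have "coeff p (Suc k) * (real (Suc k) * real h) \<in> \<rat>" by (simp only: add_diff_cancel_right')
    then have "coeff p (Suc k) * (real (Suc k) * real h) / (real (Suc k) * real h) \<in> \<rat>"
      by (rule Rats_divide) (intro Rats_mult Rats_of_nat)
    with irr \<open>h > 0\<close> show False by (simp del: of_nat_Suc)
  qed
  show "coeff (pcompose p [:of_nat h, 1:] - p) j \<in> \<rat>" if "j > k"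
    unfolding coeff_difference using rat that by (intro Rats_sum Rats_mult Rats_power) auto
qed

lemma finite_common_denominator:
  fixes A :: "real set"
  assumes "finite A" "A \<subseteq> \<rat>"
  obtains D :: nat where "D > 0" "\<And>a. a \<in> A \<Longrightarrow> real D * a \<in> \<int>"
proof -
  have "\<exists>D::nat. D > 0 \<and> (\<forall>a\<in>A. real D * a \<in> \<int>)"
    using assms
  proof (induction A rule: finite_induct)
    case empty
    then show ?case by auto
  next
    case (insert a A)
    then obtain D :: nat where D: "D > 0" "\<forall>a\<in>A. real D * a \<in> \<int>" by auto
    from insert.prems obtain m :: int and n :: nat where mn: "n > 0" "a = of_int m / of_nat n"
      unfolding Rats_eq_int_div_nat by auto
    have "real (D * n) * b \<in> \<int>" if "b \<in> insert a A" for b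
    proof (cases "b = a")
      case True
      then have "real (D * n) * b = of_int (int D * m)"
        using mn by simp
      then show ?thesis by (metis Ints_of_int)
    next
      case False
      then have "real n * (real D * b) \<in> \<int>" using that D by (intro Ints_mult[of "real n" "real D * b"]) auto
      then show ?thesis by (simp add: mult_ac)
    qed
    then show ?case using D mn by (intro exI[of _ "D * n"]) auto
  qed
  then show ?thesis using that by blast
qed

text \<open>\<open>D\<close> clears the denominators of the coefficients from degree 2 on, and
  \<open>(n + D) ^ i - n ^ i\<close> is a multiple of \<open>D\<close>. The linear term contributes
  exactly \<open>D * coeff p 1\<close>.\<close>

lemma rational_poly_periodic_mod_1:
  fixes p :: "real poly"
  assumes "\<And>j. j \<ge> 2 \<Longrightarrow> coeff p j \<in> \<rat>"
  obtains D :: nat where "D > 0"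
    "\<And>n::nat. poly p (real (n + D)) - poly p (real n) - real D * coeff p 1 \<in> \<int>"
proof -
  obtain D :: nat where D: "D > 0" "\<And>a. a \<in> coeff p ` {2..degree p} \<Longrightarrow> real D * a \<in> \<int>"
    by (rule finite_common_denominator[of "coeff p ` {2..degree p}"]) (use assms in auto)
  have "poly p (real (n + D)) - poly p (real n) - real D * coeff p 1 \<in> \<int>" for n
  proof -
    have *: "real (n + D) ^ i - real n ^ i = real D * of_int ((\<Sum>j<i. (int n + int D) ^ j * int n ^ (i - Suc j)))" for i
      using power_diff_sumr2[of "real n + real D" i "real n"] by (simp add: mult.commute)
    have "poly p (real (n + D)) - poly p (real n) = (\<Sum>i\<le>degree p. coeff p i * (real (n + D) ^ i - real n ^ i))"
      by (simp only: poly_altdef sum_subtractf[symmetric] right_diff_distrib)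
    also have "\<dots> - real D * coeff p 1 = (\<Sum>i\<le>degree p. coeff p i * (real (n + D) ^ i - real n ^ i) - (if i = 1 then real D * coeff p 1 else 0))"
      by (simp add: sum_subtractf coeff_eq_0)
    also have "\<dots> \<in> \<int>"
    proof (rule Ints_sum)
      fix i assume i: "i \<in> {..degree p}"
      consider "i = 0" | "i = 1" | "i \<ge> 2" by linarith
      then show "coeff p i * (real (n + D) ^ i - real n ^ i) - (if i = 1 then real D * coeff p 1 else 0) \<in> \<int>"
      proof cases
        case 3
        then have "(real D * coeff p i) * of_int ((\<Sum>j<i. (int n + int D) ^ j * int n ^ (i - Suc j))) \<in> \<int>"
          using D(2)[of "coeff p i"] i by (intro Ints_mult[of "real D * coeff p i"]) auto
        then show ?thesis using 3 unfolding * by (simp add: mult_ac)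
      qed auto
    qed
    finally show ?thesis .
  qed
  then show ?thesis using D(1) that by blast
qed

lemma cis_2pi_add_Ints: "z \<in> \<int> \<Longrightarrow> cis (2 * pi * (x + z)) = cis (2 * pi * x)"
  by (simp add: distrib_left flip: cis_mult)

lemma cis_2pi_eq_1_imp_Ints: "cis (2 * pi * x) = 1 \<Longrightarrow> x \<in> \<int>"
proof -
  assume "cis (2 * pi * x) = 1"
  then have "cos (2 * pi * x) = 1" by (metis cis.sel(1) one_complex.sel(1))
  then obtain m :: int where "2 * pi * x = of_int m * 2 * pi" by (auto simp: cos_one_2pi_int)
  then have "x = of_int m" by simp
  then show ?thesis by simp
qed

text \<open>Base case of the differencing. A shift leaves the mean asymptotically unchanged, yet
  here it multiplies it by a constant other than 1, because a positive multiple of an irrational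
  number is not an integer.\<close>

lemma mean_cis_poly_linear:
  assumes irr: "coeff p 1 \<notin> \<rat>" and rat: "\<And>j. j > 1 \<Longrightarrow> coeff p j \<in> \<rat>"
  shows "mean (\<lambda>n. cis (2 * pi * poly p (real n))) \<longlonglongrightarrow> 0"
proof -
  define u where "u = (\<lambda>n. cis (2 * pi * poly p (real n)))"
  \<comment> \<open>Translation by \<open>D\<close> multiplies the sequence by the constant \<open>c \<noteq> 1\<close>.\<close>
  obtain D :: nat where D: "D > 0"
    "\<And>n::nat. poly p (real (n + D)) - poly p (real n) - real D * coeff p 1 \<in> \<int>"
    using rational_poly_periodic_mod_1[of p] rat by (metis Suc_1 Suc_le_lessD)
  define c where "c = cis (2 * pi * (real D * coeff p 1))"
  have "c \<noteq> 1"
  proof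
    assume "c = 1"
    then have "real D * coeff p 1 \<in> \<int>" unfolding c_def by (rule cis_2pi_eq_1_imp_Ints)
    then have "real D * coeff p 1 / real D \<in> \<rat>" by (metis Ints_subset_Rats Rats_divide Rats_of_nat subsetD)
    then show False using irr D(1) by simp
  qed
  have "u (n + D) = c * u n" for n
  proof -
    have "u (n + D) = cis (2 * pi * ((poly p (real n) + real D * coeff p 1)
          + (poly p (real (n + D)) - poly p (real n) - real D * coeff p 1)))"
      by (simp add: u_def)
    also have "\<dots> = cis (2 * pi * (poly p (real n) + real D * coeff p 1))"
      by (intro cis_2pi_add_Ints D)
    also have "\<dots> = c * u n"
      by (simp add: c_def u_def cis_mult distrib_left add.commute)
    finally show ?thesis .
  qed
  then have eq: "mean (\<lambda>n. u (n + D)) N - mean u N = (c - 1) * mean u N" for N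
    by (simp add: mean_cmult left_diff_distrib)
  have "(\<lambda>N. mean (\<lambda>n. u (n + D)) N - mean u N) \<longlonglongrightarrow> 0"
    by (rule mean_shift_diff) (simp add: u_def)
  then have "(\<lambda>N. (1 / (c - 1)) * ((c - 1) * mean u N)) \<longlonglongrightarrow> (1 / (c - 1)) * 0"
    unfolding eq by (intro tendsto_mult tendsto_const)
  then show ?thesis using \<open>c \<noteq> 1\<close> by (simp add: u_def)
qed

text \<open>The induction runs over the position of the topmost irrational coefficient, not over the
  degree. The correlations in van der Corput's lemma are Weyl sums of the differenced
  polynomials.\<close>

lemma mean_cis_poly_top_irrational:
  assumes "coeff p (Suc k) \<notin> \<rat>" "\<And>j. j > Suc k \<Longrightarrow> coeff p j \<in> \<rat>"
  shows "mean (\<lambda>n. cis (2 * pi * poly p (real n))) \<longlonglongrightarrow> 0"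
  using assms
proof (induction k arbitrary: p)
  case 0
  then show ?case using mean_cis_poly_linear[of p] by simp
next
  case (Suc k)
  show ?case
  proof (rule van_der_Corput)
    fix h :: nat assume "h > 0"
    have "mean (\<lambda>n. cis (2 * pi * poly (pcompose p [:of_nat h, 1:] - p) (real n))) \<longlonglongrightarrow> 0"
      using Suc.prems \<open>h > 0\<close> by (intro Suc.IH irrational_coeff_difference)
    moreover have "cis (2 * pi * poly (pcompose p [:of_nat h, 1:] - p) (real n))
       = cis (2 * pi * poly p (real (n + h))) * cnj (cis (2 * pi * poly p (real n)))" for n
      by (simp add: poly_pcompose cis_cnj cis_mult right_diff_distrib add.commute)
    ultimately show "mean (\<lambda>n. cis (2 * pi * poly p (real (n + h))) * cnj (cis (2 * pi * poly p (real n)))) \<longlonglongrightarrow> 0"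
      by simp
  qed simp
qed

theorem Weyl_polynomial:
  fixes p :: "real poly"
  assumes "k \<ge> 1" "coeff p k \<notin> \<rat>"
  shows "mean (\<lambda>n. cis (2 * pi * poly p (real n))) \<longlonglongrightarrow> 0"
proof -
  define S where "S = {k. coeff p k \<notin> \<rat>}"
  have "finite S"
  proof (rule finite_subset)
    show "S \<subseteq> {..degree p}" unfolding S_def by (metis Collect_mono Rats_0 atMost_def le_degree)
  qed simp
  have "k \<in> S" using assms by (simp add: S_def)
  \<comment> \<open>\<open>k \<ge> 1\<close> forces the topmost irrational coefficient to have
    positive index; the constant term alone would only be a phase.\<close>
  then have M: "Max S \<in> S" "k \<le> Max S" using \<open>finite S\<close> by (auto intro: Max_in)
  obtain m where m: "Max S = Suc m" using M assms(1) by (cases "Max S") auto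
  show ?thesis
  proof (rule mean_cis_poly_top_irrational)
    show "coeff p (Suc m) \<notin> \<rat>" using M(1) unfolding m by (simp add: S_def)
    show "coeff p j \<in> \<rat>" if "j > Suc m" for j
    proof (rule ccontr)
      assume "coeff p j \<notin> \<rat>"
      then have "j \<le> Max S" using \<open>finite S\<close> by (intro Max_ge) (auto simp: S_def)
      with that m show False by simp
    qed
  qed
qed

subsection \<open>Simultaneous approximation by polynomials\<close>

lemma prod_cis: "(\<Prod>i\<in>I. cis (f i)) = cis (\<Sum>i\<in>I. f i)"
  by (induction I rule: infinite_finite_induct) (auto simp: cis_mult)

lemma binomial_kernel_expansion:
  assumes "finite I"
  shows "(\<Prod>i\<in>I. 1 + cis (2 * pi * y i)) ^ K
    = (\<Sum>k\<in>PiE I (\<lambda>_. {..K}). of_real (\<Prod>i\<in>I. real (K choose k i)) * cis (2 * pi * (\<Sum>i\<in>I. real (k i) * y i)))"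
proof -
  have "(\<Prod>i\<in>I. 1 + cis (2 * pi * y i)) ^ K = (\<Prod>i\<in>I. \<Sum>j\<le>K. of_nat (K choose j) * cis (2 * pi * y i) ^ j)"
    by (simp add: prod_power_distrib add.commute[of 1] binomial_ring)
  also have "\<dots> = (\<Sum>k\<in>PiE I (\<lambda>_. {..K}). \<Prod>i\<in>I. of_nat (K choose k i) * cis (2 * pi * y i) ^ k i)"
    by (rule prod_sum_PiE) (use assms in auto)
  also have "\<dots> = (\<Sum>k\<in>PiE I (\<lambda>_. {..K}). of_real (\<Prod>i\<in>I. real (K choose k i)) * cis (2 * pi * (\<Sum>i\<in>I. real (k i) * y i)))"
  proof -
    have "cis (2 * pi * y i) ^ j = cis (2 * pi * (real j * y i))" for i j
      by (simp only: Complex.DeMoivre mult_ac)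
    then show ?thesis by (simp add: prod.distrib prod_cis sum_distrib_left)
  qed
  finally show ?thesis .
qed

text \<open>
  Expanding \<open>\<bar>\<Prod> (1 + e(y\<^sub>i))\<bar>\<close> to the power \<open>2 K\<close>, the diagonal terms alone have a mean of at least
  \<open>4\<close> to the power \<open>K \<bar>I\<bar>\<close> divided by \<open>(K + 1)\<close> to the power \<open>\<bar>I\<bar>\<close> (Cauchy--Schwarz), and the
  other terms have nonnegative mean by assumption. So the kernel cannot be uniformly small.
\<close>

lemma binomial_kernel_bound:
  fixes y :: "'i \<Rightarrow> nat \<Rightarrow> real"
  assumes fin: "finite I"
    and lim: "\<And>k l :: 'i \<Rightarrow> nat. k \<in> PiE I (\<lambda>_. {..K}) \<Longrightarrow> l \<in> PiE I (\<lambda>_. {..K}) \<Longrightarrow>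
      \<exists>c\<ge>0. mean (\<lambda>n. cis (2 * pi * (\<Sum>i\<in>I. (real (k i) - real (l i)) * y i n))) \<longlonglongrightarrow> complex_of_real c"
    and bound: "\<And>n. norm (\<Prod>i\<in>I. 1 + cis (2 * pi * y i n)) \<le> b"
  shows "(2 ^ card I) ^ (2 * K) \<le> b ^ (2 * K) * real (Suc K) ^ card I"
proof -
  define T where "T = PiE I (\<lambda>_::'i. {..K})"
  define C where "C = (\<lambda>k :: 'i \<Rightarrow> nat. \<Prod>i\<in>I. real (K choose k i))"
  define S where "S = (\<lambda>n. (\<Prod>i\<in>I. 1 + cis (2 * pi * y i n)) ^ K)"
  define f where "f = (\<lambda>k l n. cis (2 * pi * (\<Sum>i\<in>I. (real (k i) - real (l i)) * y i n)))"
  have finT: "finite T" unfolding T_def using fin by (intro finite_PiE) auto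
  have C_nonneg: "C k \<ge> 0" for k by (simp add: C_def prod_nonneg)
  have SS: "S n * cnj (S n) = (\<Sum>k\<in>T. \<Sum>l\<in>T. of_real (C k * C l) * f k l n)" for n
  proof -
    have eq: "cis (2 * pi * (\<Sum>i\<in>I. real (k i) * y i n)) * cnj (cis (2 * pi * (\<Sum>i\<in>I. real (l i) * y i n))) = f k l n" for k l
      by (simp add: f_def cis_cnj cis_mult left_diff_distrib sum_subtractf right_diff_distrib)
    have "S n = (\<Sum>k\<in>T. of_real (C k) * cis (2 * pi * (\<Sum>i\<in>I. real (k i) * y i n)))"
      by (simp only: S_def binomial_kernel_expansion[OF fin] C_def T_def)
    then show ?thesis
      by (simp add: sum_product eq[symmetric] mult_ac)
  qed
  define c where "c = (\<lambda>k l. SOME c. c \<ge> 0 \<and> mean (f k l) \<longlonglongrightarrow> complex_of_real c)"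
  have c: "c k l \<ge> 0" "mean (f k l) \<longlonglongrightarrow> complex_of_real (c k l)" if "k \<in> T" "l \<in> T" for k l
    using someI_ex[OF lim[OF that[unfolded T_def]]] unfolding c_def f_def by blast+
  have c_diag: "c k k = 1" if "k \<in> T" for k
  proof -
    have "mean (f k k) \<longlonglongrightarrow> 1" unfolding f_def by (simp add: mean_const)
    then show ?thesis using c(2)[OF that that] LIMSEQ_unique of_real_eq_1_iff by blast
  qed
  have "(\<lambda>N. \<Sum>k\<in>T. \<Sum>l\<in>T. of_real (C k * C l) * mean (f k l) N)
      \<longlonglongrightarrow> (\<Sum>k\<in>T. \<Sum>l\<in>T. of_real (C k * C l) * complex_of_real (c k l))"
    by (intro tendsto_sum tendsto_mult tendsto_const c)
  also have "(\<lambda>N. \<Sum>k\<in>T. \<Sum>l\<in>T. of_real (C k * C l) * mean (f k l) N) = mean (\<lambda>n. S n * cnj (S n))"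
    by (simp only: SS mean_sum mean_cmult fun_eq_iff) simp
  also have "(\<Sum>k\<in>T. \<Sum>l\<in>T. of_real (C k * C l) * complex_of_real (c k l)) = complex_of_real (\<Sum>k\<in>T. \<Sum>l\<in>T. C k * C l * c k l)"
    by simp
  finally have lim_SS: "mean (\<lambda>n. S n * cnj (S n)) \<longlonglongrightarrow> complex_of_real (\<Sum>k\<in>T. \<Sum>l\<in>T. C k * C l * c k l)" .
  have "norm (mean (\<lambda>n. S n * cnj (S n)) N) \<le> b ^ (2 * K)" for N
  proof (rule norm_mean_le)
    have "b \<ge> 0" using norm_ge_zero bound order_trans by blast
    then show "b ^ (2 * K) \<ge> 0" by simp
    show "norm (S n * cnj (S n)) \<le> b ^ (2 * K)" for n
    proof -
      have "norm (S n) \<le> b ^ K" unfolding S_def norm_power using bound by (intro power_mono) auto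
      then have "norm (S n) * norm (S n) \<le> b ^ K * b ^ K" by (intro mult_mono) (use \<open>b \<ge> 0\<close> in auto)
      then show ?thesis by (simp add: norm_mult power_add mult_2)
    qed
  qed
  then have "norm (complex_of_real (\<Sum>k\<in>T. \<Sum>l\<in>T. C k * C l * c k l)) \<le> b ^ (2 * K)"
    using LIMSEQ_le_const2[OF tendsto_norm[OF lim_SS]] by blast
  then have upper: "(\<Sum>k\<in>T. \<Sum>l\<in>T. C k * C l * c k l) \<le> b ^ (2 * K)" by (simp only: norm_of_real)
  have "(\<Sum>k\<in>T. (C k)\<^sup>2) \<le> (\<Sum>k\<in>T. \<Sum>l\<in>T. C k * C l * c k l)"
  proof (rule sum_mono)
    fix k assume k: "k \<in> T"
    have "C k * C k * c k k \<le> (\<Sum>l\<in>T. C k * C l * c k l)"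
      by (rule member_le_sum) (use k finT c C_nonneg in \<open>auto intro!: mult_nonneg_nonneg\<close>)
    then show "(C k)\<^sup>2 \<le> (\<Sum>l\<in>T. C k * C l * c k l)" by (simp add: c_diag k power2_eq_square)
  qed
  then have "(\<Sum>k\<in>T. (C k)\<^sup>2) \<le> b ^ (2 * K)" using upper by linarith
  moreover have "(\<Sum>k\<in>T. C k)\<^sup>2 \<le> (\<Sum>k\<in>T. (C k)\<^sup>2) * card T"
    by (rule sum_squared_le_sum_of_squares)
  moreover have "(\<Sum>k\<in>T. C k) = (2 ^ K) ^ card I"
  proof -
    have "(\<Sum>k\<in>T. C k) = (\<Prod>i\<in>I. \<Sum>j\<le>K. real (K choose j))"
      unfolding C_def T_def by (rule prod_sum_PiE[symmetric]) (use fin in auto)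
    also have "(\<Sum>j\<le>K. real (K choose j)) = 2 ^ K"
      using choose_row_sum[of K] by (metis of_nat_numeral of_nat_power of_nat_sum)
    finally show ?thesis by simp
  qed
  moreover have "card T = Suc K ^ card I" unfolding T_def using fin by (simp add: card_PiE)
  ultimately have "((2 ^ K) ^ card I)\<^sup>2 \<le> (\<Sum>k\<in>T. (C k)\<^sup>2) * real (Suc K ^ card I)"
    by metis
  also have "\<dots> \<le> b ^ (2 * K) * real (Suc K ^ card I)"
    using \<open>(\<Sum>k\<in>T. (C k)\<^sup>2) \<le> b ^ (2 * K)\<close> by (intro mult_right_mono) auto
  also have "((2::real) ^ K) ^ card I = (2 ^ card I) ^ K" by (simp add: mult.commute flip: power_mult)
  finally show ?thesis by (simp only: of_nat_power mult.commute[of 2] power_mult)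
qed

lemma norm_one_plus_cis: "norm (1 + cis (2 * pi * x)) = 2 * \<bar>cos (pi * x)\<bar>"
proof -
  have "(norm (1 + cis (2 * pi * x)))\<^sup>2 = (2 * \<bar>cos (pi * x)\<bar>)\<^sup>2"
  proof -
    have "(norm (1 + cis t))\<^sup>2 = 2 + 2 * cos t" for t
      using sin_cos_squared_add[of t] unfolding cmod_power2 by (simp add: power2_eq_square algebra_simps)
    then show ?thesis by (simp add: cos_double_cos power_mult_distrib mult.assoc)
  qed
  then show ?thesis by (intro power2_eq_imp_eq[of "norm (1 + cis (2 * pi * x))"]) auto
qed

text \<open>The function \<open>\<bar>cos (pi * x)\<bar>\<close> is even, has period 1 and decreases
  on \<open>[0, 1/2]\<close>, so only the distance \<open>r\<close> to the nearest integer
  matters.\<close>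

lemma abs_cos_far_from_Ints:
  assumes "0 \<le> e" "\<And>z::int. \<bar>x - of_int z\<bar> \<ge> e"
  shows "\<bar>cos (pi * x)\<bar> \<le> cos (pi * e)"
proof -
  define r where "r = \<bar>x - of_int (round x)\<bar>"
  have r: "e \<le> r" "r \<le> 1 / 2"
    using assms(2)[of "round x"] of_int_round_abs_le[of x] by (auto simp: r_def abs_minus_commute)
  have "\<bar>cos (pi * x)\<bar> = \<bar>cos (pi * (x - of_int (round x)))\<bar>"
    by (simp add: right_diff_distrib cos_diff abs_mult)
  also have "\<dots> = \<bar>cos (pi * r)\<bar>"
    unfolding r_def by (metis abs_mult abs_of_nonneg cos_abs_real pi_ge_zero)
  also have "\<dots> = cos (pi * r)"
    using r assms(1) by (intro abs_of_nonneg cos_ge_zero) (auto simp: field_simps intro: order_trans[of _ 0])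
  also have "\<dots> \<le> cos (pi * e)"
    using r assms(1) by (intro cos_monotone_0_pi_le) auto
  finally show ?thesis .
qed

section \<open>A Kronecker theorem for polynomial sequences\<close>

lemma poly_rational_multiple_Ints:
  fixes p :: "real poly"
  assumes "coeff p 0 = 0" "\<And>j. real N * coeff p j \<in> \<int>"
  shows "poly p (real (N * n)) \<in> \<int>"
  unfolding poly_altdef
proof (rule Ints_sum)
  fix i
  show "coeff p i * real (N * n) ^ i \<in> \<int>"
  proof (cases i)
    case 0
    then show ?thesis using assms(1) by simp
  next
    case (Suc j)
    \<comment> \<open>A term of positive degree supplies one factor \<open>N\<close>, which clears
      the denominator of its coefficient.\<close>
    have "(real N * coeff p i) * (real N ^ j * real n ^ i) \<in> \<int>"
      by (intro Ints_mult[OF assms(2)] Ints_mult Ints_power) auto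
    then show ?thesis by (simp add: Suc power_mult_distrib mult_ac)
  qed
qed

text \<open>Either all coefficients are rational, and along multiples of \<open>N\<close> every term
  equals 1; or some coefficient of positive degree is irrational, it stays so after replacing
  \<open>X\<close> by \<open>N X\<close>, and Weyl's theorem gives mean 0. Without passing to
  multiples, a rational polynomial may produce a mean that is not a nonnegative real.
  \<open>Suc n\<close> keeps the index positive.\<close>

lemma mean_cis_poly_multiples:
  fixes p :: "real poly"
  assumes "coeff p 0 = 0" "N > 0"
    and rat: "(\<And>j. coeff p j \<in> \<rat>) \<Longrightarrow> (\<forall>j. real N * coeff p j \<in> \<int>) \<and> c \<in> \<int>"
  shows "\<exists>v\<ge>0. mean (\<lambda>n. cis (2 * pi * (poly p (real (N * Suc n)) - c))) \<longlonglongrightarrow> complex_of_real v"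
proof (cases "\<forall>j. coeff p j \<in> \<rat>")
  case True
  then have "poly p (real (N * Suc n)) - c \<in> \<int>" for n
    using rat assms(1) poly_rational_multiple_Ints[of p N "Suc n"] by (intro Ints_diff) auto
  then have "cis (2 * pi * (poly p (real (N * Suc n)) - c)) = 1" for n
    by (rule cis_multiple_2pi)
  then show ?thesis using mean_const[of 1] by (intro exI[of _ 1]) simp
next
  case False
  then obtain j where j: "coeff p j \<notin> \<rat>" by auto
  then have "j \<ge> 1" using assms(1) by (cases j) auto
  define q where "q = pcompose p [:0, real N:]"
  have "coeff q j \<notin> \<rat>"
  proof
    assume "coeff q j \<in> \<rat>"
    then have "coeff q j / real N ^ j \<in> \<rat>" by (intro Rats_divide Rats_power) auto
    then show False using j assms(2) by (simp add: q_def coeff_pcompose_linear)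
  qed
  then have "mean (\<lambda>n. cis (2 * pi * poly q (real n))) \<longlonglongrightarrow> 0"
    using Weyl_polynomial \<open>j \<ge> 1\<close> by blast
  then have "mean (\<lambda>n. cis (2 * pi * poly q (real (n + 1)))) \<longlonglongrightarrow> 0"
    by (intro mean_shift[where h = 1 and f = "\<lambda>n. cis (2 * pi * poly q (real n))"]) auto
  then have "(\<lambda>M. cis (- (2 * pi * c)) * mean (\<lambda>n. cis (2 * pi * poly q (real (n + 1)))) M) \<longlonglongrightarrow> cis (- (2 * pi * c)) * 0"
    by (intro tendsto_mult tendsto_const)
  also have "(\<lambda>M. cis (- (2 * pi * c)) * mean (\<lambda>n. cis (2 * pi * poly q (real (n + 1)))) M)
     = mean (\<lambda>n. cis (2 * pi * (poly p (real (N * Suc n)) - c)))"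
    unfolding mean_cmult[symmetric]
    by (rule arg_cong[of _ _ mean]) (auto simp: fun_eq_iff q_def poly_pcompose cis_mult algebra_simps)
  finally show ?thesis by (intro exI[of _ 0]) simp
qed

text \<open>If every \<open>n\<close> fails at some index, one factor of the kernel is always at
  most \<open>2 * \<rho>\<close> with \<open>\<rho> < 1\<close>. The lower bound for the kernel then
  forces an exponentially decaying quantity times a power of \<open>K + 1\<close> to stay above
  1.\<close>

theorem polynomial_Kronecker:
  fixes W :: "'i \<Rightarrow> real poly" and w :: "'i \<Rightarrow> real"
  assumes fin: "finite I" and zero: "\<And>i. i \<in> I \<Longrightarrow> coeff (W i) 0 = 0"
    and rel: "\<And>k :: 'i \<Rightarrow> int. (\<And>j. coeff (\<Sum>i\<in>I. smult (of_int (k i)) (W i)) j \<in> \<rat>)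
        \<Longrightarrow> (\<Sum>i\<in>I. of_int (k i) * w i) \<in> \<int>"
    and e: "e > 0"
  obtains n :: nat where "n \<ge> 1" "\<And>i. i \<in> I \<Longrightarrow> \<exists>z::int. \<bar>poly (W i) (real n) - w i - of_int z\<bar> < e"
proof (rule ccontr)
  assume no: "\<not> thesis"
  note witness = that
  have far: "\<exists>i\<in>I. \<forall>z::int. \<bar>poly (W i) (real n) - w i - of_int z\<bar> \<ge> e" if "n \<ge> 1" for n :: nat
    using witness[OF that] no by (meson not_le)
  \<comment> \<open>The cap at \<open>1 / 2\<close> keeps the angle in the first quadrant, where the
    cosine is nonnegative and decreasing.\<close>
  define \<rho> where "\<rho> = cos (pi * min e (1 / 2))"
  have \<rho>: "0 \<le> \<rho>" "\<rho> < 1"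
  proof -
    have "min e (1 / 2) \<le> 1 / 2" "min e (1/2) > 0" using e by auto
    then have "pi * min e (1 / 2) \<le> pi * (1 / 2)" "pi * min e (1/2) > 0"
      by (intro mult_left_mono mult_pos_pos; simp)+
    then show "0 \<le> \<rho>" "\<rho> < 1"
      using cos_monotone_0_pi[of 0 "pi * min e (1/2)"] cos_ge_zero[of "pi * min e (1 / 2)"] pi_gt_zero
      unfolding \<rho>_def cos_zero by linarith+
  qed
  have prod_bound: "norm (\<Prod>i\<in>I. 1 + cis (2 * pi * (poly (W i) (real n) - w i))) \<le> 2 ^ card I * \<rho>" if n: "n \<ge> 1" for n :: nat
  proof -
    obtain i where i: "i \<in> I" "\<And>z::int. \<bar>poly (W i) (real n) - w i - of_int z\<bar> \<ge> e" using far[OF n] by auto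
    have "\<bar>cos (pi * (poly (W i) (real n) - w i))\<bar> \<le> \<rho>"
      unfolding \<rho>_def using i(2) e by (intro abs_cos_far_from_Ints) (auto intro: min.coboundedI1)
    moreover have "norm (\<Prod>i\<in>I - {i}. 1 + cis (2 * pi * (poly (W i) (real n) - w i))) \<le> 2 ^ card (I - {i})"
    proof -
      have "norm (\<Prod>i\<in>I - {i}. 1 + cis (2 * pi * (poly (W i) (real n) - w i)))
          = (\<Prod>i\<in>I - {i}. 2 * \<bar>cos (pi * (poly (W i) (real n) - w i))\<bar>)"
        by (simp only: prod_norm[symmetric] norm_one_plus_cis)
      also have "\<dots> \<le> (\<Prod>i\<in>I - {i}. 2)"
        by (intro prod_mono) auto
      finally show ?thesis by simp
    qed
    ultimately have "norm (1 + cis (2 * pi * (poly (W i) (real n) - w i))) * norm (\<Prod>i\<in>I - {i}. 1 + cis (2 * pi * (poly (W i) (real n) - w i)))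
        \<le> (2 * \<rho>) * 2 ^ card (I - {i})"
      unfolding norm_one_plus_cis using \<rho> by (intro mult_mono) auto
    moreover have "(2::real) ^ card I = 2 * 2 ^ card (I - {i})"
      using fin i(1) by (simp add: card_Diff_singleton flip: power_Suc) (metis Suc_pred card_gt_0_iff empty_iff)
    ultimately show ?thesis using fin i(1) by (simp add: prod.remove[of I i] norm_mult mult_ac)
  qed
  have key: "1 \<le> \<rho> ^ (2 * K) * real (Suc K) ^ card I" for K
  proof -
    \<comment> \<open>For fixed \<open>K\<close> only finitely many integer combinations \<open>V\<close> of the \<open>W i\<close> occur, so one \<open>N\<close>
      makes all rational ones integer-valued on the multiples of \<open>N\<close>.\<close>
    define V where "V = (\<lambda>(k :: 'i \<Rightarrow> nat, l :: 'i \<Rightarrow> nat). \<Sum>i\<in>I. smult (of_int (int (k i) - int (l i))) (W i))"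
    define T where "T = PiE I (\<lambda>_::'i. {..K}) \<times> PiE I (\<lambda>_::'i. {..K})"
    define A where "A = (\<Union>t\<in>T. coeff (V t) ` {..degree (V t)}) \<inter> \<rat>"
    have "finite A" "A \<subseteq> \<rat>" unfolding A_def T_def using fin by (auto intro!: finite_PiE)
    then obtain N :: nat where N: "N > 0" "\<And>a. a \<in> A \<Longrightarrow> real N * a \<in> \<int>"
      using finite_common_denominator by blast
    have "(2 ^ card I) ^ (2 * K) \<le> (2 ^ card I * \<rho>) ^ (2 * K) * real (Suc K) ^ card I"
    proof (rule binomial_kernel_bound[OF fin])
      fix k l :: "'i \<Rightarrow> nat" assume kl: "k \<in> PiE I (\<lambda>_. {..K})" "l \<in> PiE I (\<lambda>_. {..K})"
      define p where "p = V (k, l)"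
      define c where "c = (\<Sum>i\<in>I. of_int (int (k i) - int (l i)) * w i)"
      have "\<exists>v\<ge>0. mean (\<lambda>n. cis (2 * pi * (poly p (real (N * Suc n)) - c))) \<longlonglongrightarrow> complex_of_real v"
      proof (rule mean_cis_poly_multiples)
        show "coeff p 0 = 0" by (simp add: p_def V_def coeff_sum zero)
        assume rat: "\<And>j. coeff p j \<in> \<rat>"
        then have "c \<in> \<int>" unfolding c_def p_def V_def by (intro rel) simp
        moreover have "real N * coeff p j \<in> \<int>" for j
        proof (cases "j \<le> degree p")
          case True
          then have "coeff p j \<in> A" using rat kl unfolding A_def T_def p_def by blast
          then show ?thesis by (rule N)
        qed (simp add: coeff_eq_0)
        ultimately show "(\<forall>j. real N * coeff p j \<in> \<int>) \<and> c \<in> \<int>" by blast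
      qed (rule N)
      moreover have "poly p x - c = (\<Sum>i\<in>I. (real (k i) - real (l i)) * (poly (W i) x - w i))" for x
        by (simp add: p_def V_def c_def poly_sum sum_subtractf[symmetric] right_diff_distrib)
      ultimately show "\<exists>v\<ge>0. mean (\<lambda>n. cis (2 * pi * (\<Sum>i\<in>I. (real (k i) - real (l i)) * (poly (W i) (real (N * Suc n)) - w i)))) \<longlonglongrightarrow> complex_of_real v"
        by simp
    next
      show "norm (\<Prod>i\<in>I. 1 + cis (2 * pi * (poly (W i) (real (N * Suc n)) - w i))) \<le> 2 ^ card I * \<rho>" for n
        using N(1) by (intro prod_bound) auto
    qed
    then have "(2 ^ card I) ^ (2 * K) * 1 \<le> (2 ^ card I) ^ (2 * K) * (\<rho> ^ (2 * K) * real (Suc K) ^ card I)"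
      by (simp only: power_mult_distrib mult_ac mult_1_right mult_1_left)
    then show ?thesis by (subst (asm) mult_le_cancel_left_pos) auto
  qed
  have "(\<lambda>K. \<rho> ^ (2 * K) * real (Suc K) ^ card I) \<longlonglongrightarrow> 0"
  proof -
    \<comment> \<open>The index failing at \<open>n = 1\<close> shows that \<open>I\<close> is
      nonempty; both the root and the limit \<open>0 ^ card I = 0\<close> rely on this.\<close>
    obtain i where "i \<in> I" using far[of 1] by auto
    then have card: "card I > 0" using fin by (auto simp: card_gt_0_iff)
    \<comment> \<open>\<open>x\<close> is chosen so that the sequence becomes the \<open>card I\<close>-th power of \<open>(K + 1) x ^ K\<close>.\<close>
    define x where "x = root (card I) (\<rho>\<^sup>2)"
    have x: "x ^ card I = \<rho>\<^sup>2" "0 \<le> x" "x < 1"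
      using card \<rho> by (auto simp: x_def real_root_lt_1_iff power_less_one_iff abs_square_less_1)
    have "(\<lambda>K. real K * x ^ K + x ^ K) \<longlonglongrightarrow> 0 + 0"
      using x by (intro tendsto_add powser_times_n_limit_0 LIMSEQ_power_zero) auto
    then have "(\<lambda>K. (real K * x ^ K + x ^ K) ^ card I) \<longlonglongrightarrow> (0 + 0) ^ card I"
      by (rule tendsto_power)
    moreover have "(real K * x ^ K + x ^ K) ^ card I = \<rho> ^ (2 * K) * real (Suc K) ^ card I" for K
    proof -
      have "real K * x ^ K + x ^ K = x ^ K * real (Suc K)" by (simp add: algebra_simps)
      moreover have "(x ^ K) ^ card I = \<rho> ^ (2 * K)"
        by (metis x(1) power_mult mult.commute)
      ultimately show ?thesis by (simp only: power_mult_distrib)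
    qed
    ultimately show ?thesis using card by (simp only: add_0 zero_power)
  qed
  then have "\<forall>\<^sub>F K in sequentially. \<rho> ^ (2 * K) * real (Suc K) ^ card I < 1"
    by (rule order_tendstoD) simp
  then show False using key by (auto simp: eventually_sequentially not_less[symmetric])
qed

subsection \<open>Functionals on real polynomials modulo rational ones\<close>

lemma Q_independentD:
  assumes "Q_independent P" "\<And>k. coeff (\<Sum>i\<in>UNIV. smult (of_rat (r i)) (P i)) k \<in> \<rat>"
  shows "r i = 0"
  using assms unfolding Q_independent_def by blast

text \<open>Equal entries would make \<open>P i - P j = 0\<close> a forbidden rational combination.
  Injectivity permits passing from the family \<open>P\<close> to the set
  \<open>range P\<close>.\<close>

lemma Q_independent_inj:
  fixes P :: "'d::finite \<Rightarrow> real poly"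
  assumes "Q_independent P"
  shows "inj P"
proof (rule injI, rule ccontr)
  fix i j assume eq: "P i = P j" and "i \<noteq> j"
  define r :: "'d \<Rightarrow> rat" where "r = (\<lambda>k. (if k = i then 1 else 0) - (if k = j then 1 else 0))"
  have "smult (of_rat (r k)) (P k) = (if k = i then P k else 0) - (if k = j then P k else 0)" for k
    by (simp add: r_def)
  then have "(\<Sum>k\<in>UNIV. smult (of_rat (r k)) (P k)) = 0"
    by (simp add: sum_subtractf eq)
  then have "r i = 0" by (intro Q_independentD[OF assms]) simp
  then show False using \<open>i \<noteq> j\<close> by (simp add: r_def)
qed

lemma Q_independent_irrational:
  fixes P :: "'d::finite \<Rightarrow> real poly"
  assumes "Q_independent P"
  shows "\<exists>k. coeff (P i) k \<notin> \<rat>"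
proof (rule ccontr)
  assume *: "\<nexists>k. coeff (P i) k \<notin> \<rat>"
  have "smult (of_rat (if k = i then 1 else 0)) (P k) = (if k = i then P k else 0)" for k
    by simp
  then have "(\<Sum>k\<in>UNIV. smult (of_rat (if k = i then 1 else 0)) (P k)) = P i"
    by simp
  then have "(if i = i then 1 else 0) = (0::rat)"
    using * by (intro Q_independentD[OF assms, where r = "\<lambda>k. if k = i then 1 else 0"]) simp
  then show False by simp
qed

lemma vector_space_rat_poly: "vector_space (\<lambda>r. smult (of_rat r) :: real poly \<Rightarrow> real poly)"
  by unfold_locales (simp_all add: of_rat_add smult_add_left smult_add_right of_rat_mult)

lemma vector_space_rat_real: "vector_space (\<lambda>r x. of_rat r * x :: real)"
  by unfold_locales (simp_all add: of_rat_add of_rat_mult algebra_simps)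

text \<open>
  The monomials are added because a \<open>\<rat>\<close>-linear functional vanishing on them vanishes on \<open>\<rat>[X]\<close>.
\<close>

lemma Q_independent_with_monoms:
  fixes P :: "'d::finite \<Rightarrow> real poly"
  assumes "Q_independent P"
  shows "\<not> module.dependent (\<lambda>r. smult (of_rat r)) (range P \<union> range (monom 1))"
proof -
  interpret vector_space "\<lambda>r. smult (of_rat r) :: real poly \<Rightarrow> real poly"
    by (rule vector_space_rat_poly)
  show ?thesis
    unfolding independent_explicit_finite_subsets
  proof (intro allI impI)
    fix S :: "real poly set" and u :: "real poly \<Rightarrow> rat"
    assume S: "S \<subseteq> range P \<union> range (monom 1)" "finite S" "(\<Sum>v\<in>S. smult (of_rat (u v)) v) = 0"
    define M where "M = S - range P"
    define Q where "Q = (\<Sum>v\<in>M. smult (of_rat (u v)) v)"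
    define r where "r = (\<lambda>i. if P i \<in> S then u (P i) else 0)"
    have M: "finite M" "M \<subseteq> range (monom 1)" using S by (auto simp: M_def)
    have "(\<Sum>v\<in>S \<inter> range P. smult (of_rat (u v)) v) = (\<Sum>i\<in>{i. P i \<in> S}. smult (of_rat (u (P i))) (P i))"
      by (rule sum.reindex_cong[of P]) (auto intro: inj_on_subset[OF Q_independent_inj[OF assms]])
    also have "\<dots> = (\<Sum>i\<in>UNIV. smult (of_rat (r i)) (P i))"
      by (rule sum.mono_neutral_cong_left) (auto simp: r_def)
    finally have sumP: "(\<Sum>v\<in>S \<inter> range P. smult (of_rat (u v)) v) = (\<Sum>i\<in>UNIV. smult (of_rat (r i)) (P i))" .
    have split: "(\<Sum>i\<in>UNIV. smult (of_rat (r i)) (P i)) + Q = 0"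
      using S sum.Int_Diff[of S "\<lambda>v. smult (of_rat (u v)) v" "range P"]
      by (simp add: sumP[symmetric] Q_def M_def)
    have coeff_Q: "coeff Q k = (if monom 1 k \<in> M then of_rat (u (monom 1 k)) else 0)" for k
    proof -
      have "coeff Q k = (\<Sum>v\<in>M. of_rat (u v) * coeff v k)" by (simp add: Q_def coeff_sum)
      also have "\<dots> = (\<Sum>v\<in>M. if v = monom 1 k then of_rat (u v) else 0)"
        using M(2) by (intro sum.cong) (auto simp: monom_eq_iff')
      finally show ?thesis using M(1) by simp
    qed
    \<comment> \<open>The combination of the \<open>P i\<close> equals \<open>- Q\<close>, whose
      coefficients are rational, so independence modulo rational polynomials applies.\<close>
    have r0: "r i = 0" for i
    proof (rule Q_independentD[OF assms])
      show "coeff (\<Sum>i\<in>UNIV. smult (of_rat (r i)) (P i)) k \<in> \<rat>" for k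
      proof -
        have "(\<Sum>i\<in>UNIV. smult (of_rat (r i)) (P i)) = - Q" using split by (rule eq_neg_iff_add_eq_0[THEN iffD2])
        then show ?thesis by (simp add: coeff_Q)
      qed
    qed
    then have "Q = 0" using split by simp
    show "\<forall>v\<in>S. u v = 0"
    proof
      fix v assume v: "v \<in> S"
      show "u v = 0"
      proof (cases "v \<in> range P")
        case True
        then obtain i where "v = P i" by auto
        then show ?thesis using r0[of i] v by (simp add: r_def)
      next
        case False
        then obtain k where "v = monom 1 k" "v \<in> M" using v M by (auto simp: M_def)
        then show ?thesis using coeff_Q[of k] \<open>Q = 0\<close> by simp
      qed
    qed
  qed
qed

text \<open>On a set independent over the rationals the values of a linear map can be prescribed
  freely: 1 at \<open>P i\<close>, 0 at the other \<open>P j\<close> and at all monomials. The map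
  is only linear over the rationals, hence merely additive over the reals.\<close>

lemma Q_independent_dual:
  fixes P :: "'d::finite \<Rightarrow> real poly"
  assumes "Q_independent P"
  obtains \<phi> :: "'d \<Rightarrow> real poly \<Rightarrow> real" where
    "\<And>i p q. \<phi> i (p + q) = \<phi> i p + \<phi> i q"
    "\<And>i j. \<phi> i (P j) = (if i = j then 1 else 0)"
    "\<And>i p. (\<And>k. coeff p k \<in> \<rat>) \<Longrightarrow> \<phi> i p = 0"
proof -
  interpret vector_space_pair "\<lambda>r. smult (of_rat r) :: real poly \<Rightarrow> real poly" "\<lambda>r x. of_rat r * x :: real"
    using vector_space_rat_poly vector_space_rat_real by (rule vector_space_pair.intro)
  have "\<exists>g. (\<forall>p q. g (p + q) = g p + g q) \<and> (\<forall>j. g (P j) = (if i = j then 1 else (0::real)))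
      \<and> (\<forall>p. (\<forall>k. coeff p k \<in> \<rat>) \<longrightarrow> g p = 0)" for i
  proof -
    obtain g where "Vector_Spaces.linear (\<lambda>r. smult (of_rat r)) (\<lambda>r x. of_rat r * x) g"
      and g: "\<forall>p\<in>range P \<union> range (monom 1). g p = (if p = P i then 1 else (0::real))"
      using linear_independent_extend[OF Q_independent_with_monoms[OF assms], of "\<lambda>p. if p = P i then 1 else 0"]
      by blast
    then interpret g: Vector_Spaces.linear "\<lambda>r. smult (of_rat r) :: real poly \<Rightarrow> real poly" "\<lambda>r x. of_rat r * x :: real" g
      by simp
    have "g p = 0" if p: "\<forall>k. coeff p k \<in> \<rat>" for p
    proof -
      have monom: "g (monom (coeff p k) k) = 0" for k
      proof -
        obtain r :: rat where "coeff p k = of_rat r" using p by (auto elim: Rats_cases)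
        then have "g (monom (coeff p k) k) = of_rat r * g (monom 1 k)"
          using g.scale[of r "monom 1 k"] by (simp add: smult_monom)
        \<comment> \<open>Otherwise the value prescribed at this monomial would be 1 instead of
          0.\<close>
        moreover have "monom 1 k \<noteq> P i"
          using Q_independent_irrational[OF assms, of i] by (metis Rats_0 Rats_1 coeff_monom)
        ultimately show ?thesis using g by simp
      qed
      have "g p = g (\<Sum>k\<le>degree p. monom (coeff p k) k)" by (simp only: poly_as_sum_of_monoms)
      also have "\<dots> = 0" by (simp only: g.sum monom sum.neutral_const)
      finally show ?thesis .
    qed
    then show ?thesis using g g.add inj_eq[OF Q_independent_inj[OF assms]] by (intro exI[of _ g]) auto
  qed
  then show ?thesis using that by metis
qed

subsection \<open>Trigonometric polynomials as functions of angles\<close>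

text \<open>
  \<open>t l j\<close> stands for the angle \<open>l x\<^sub>j\<close>. Closeness of angles is modulo \<open>2 \<pi>\<close>, so an angular function
  is a continuous function on a torus of finite dimension if \<open>L\<close> is finite. The entries \<open>t l j\<close> for
  different \<open>l\<close> are independent variables: the functionals \<open>\<psi>\<^sub>u\<close> are not \<open>\<real>\<close>-linear, so the value
  at \<open>l P\<close> is not \<open>l\<close> times the value at \<open>P\<close>.
\<close>

definition angular :: "real set \<Rightarrow> ((real \<Rightarrow> 'n \<Rightarrow> real) \<Rightarrow> real) \<Rightarrow> bool" where
  "angular L h \<longleftrightarrow> (\<exists>B. \<forall>t. \<bar>h t\<bar> \<le> B) \<and>
     (\<forall>e>0. \<exists>d>0. \<forall>s t. (\<forall>l\<in>L. \<forall>j. \<exists>z::int. \<bar>s l j - t l j - 2 * pi * of_int z\<bar> < d) \<longrightarrow> \<bar>h s - h t\<bar> < e)"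

text \<open>A positive bound is arranged because the estimate for products divides by it.\<close>

lemma angular_bounded: "angular L h \<Longrightarrow> \<exists>B>0. \<forall>t. \<bar>h t\<bar> \<le> B"
proof -
  assume "angular L h"
  then obtain B where "\<And>t. \<bar>h t\<bar> \<le> B" unfolding angular_def by blast
  then have "\<bar>h t\<bar> \<le> max B 1" for t by (rule max.coboundedI1)
  then show ?thesis by (intro exI[of _ "max B 1"]) auto
qed

lemma angularD:
  assumes "angular L h" "e > 0"
  obtains d where "d > 0" "\<And>s t. (\<And>l j. l \<in> L \<Longrightarrow> \<exists>z::int. \<bar>s l j - t l j - 2 * pi * of_int z\<bar> < d) \<Longrightarrow> \<bar>h s - h t\<bar> < e"
proof -
  obtain d where d: "d > 0"
    "\<forall>s t. (\<forall>l\<in>L. \<forall>j. \<exists>z::int. \<bar>s l j - t l j - 2 * pi * of_int z\<bar> < d) \<longrightarrow> \<bar>h s - h t\<bar> < e"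
    using assms unfolding angular_def by meson
  show thesis
  proof (rule that[OF d(1)])
    fix s t :: "real \<Rightarrow> 'a \<Rightarrow> real"
    assume "\<And>l j. l \<in> L \<Longrightarrow> \<exists>z::int. \<bar>s l j - t l j - 2 * pi * of_int z\<bar> < d"
    then show "\<bar>h s - h t\<bar> < e" by (intro d(2)[rule_format])
  qed
qed

lemma angular_mono: "angular L h \<Longrightarrow> L \<subseteq> L' \<Longrightarrow> angular L' h"
  unfolding angular_def by (meson subsetD)

lemma abs_cos_diff_le: "\<bar>cos x - cos y\<bar> \<le> \<bar>x - y\<bar>" for x y :: real
proof -
  have "\<bar>cos x - cos y\<bar> = 2 * \<bar>sin ((x + y) / 2)\<bar> * \<bar>sin ((y - x) / 2)\<bar>"
    by (simp add: cos_diff_cos abs_mult)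
  also have "\<dots> \<le> 2 * 1 * \<bar>(y - x) / 2\<bar>"
    using abs_sin_x_le_abs_x[of "(y - x) / 2"] by (intro mult_mono) auto
  finally show ?thesis by simp
qed

text \<open>The cosine is 1-Lipschitz and \<open>2 * pi\<close>-periodic, so \<open>d = e\<close>
  works. The phase \<open>c\<close> covers the sine.\<close>

lemma angular_cos: "angular {l} (\<lambda>t. cos (t l j + c))"
  unfolding angular_def
proof (intro conjI allI impI)
  show "\<exists>B. \<forall>t. \<bar>cos (t l j + c)\<bar> \<le> B" using abs_cos_le_one by blast
  fix e :: real assume "e > 0"
  have "\<bar>cos (x + c) - cos (y + c)\<bar> < e" if "\<bar>x - y - 2 * pi * of_int z\<bar> < e" for x y and z :: int
  proof -
    have "cos (x + c) = cos (x + c - 2 * pi * of_int z)"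
      by (simp add: cos_diff)
    then have "\<bar>cos (x + c) - cos (y + c)\<bar> \<le> \<bar>x - y - 2 * pi * of_int z\<bar>"
      using abs_cos_diff_le[of "x + c - 2 * pi * of_int z" "y + c"] by (simp add: algebra_simps)
    then show ?thesis using that by linarith
  qed
  then show "\<exists>d>0. \<forall>s t. (\<forall>l'\<in>{l}. \<forall>j. \<exists>z::int. \<bar>s l' j - t l' j - 2 * pi * of_int z\<bar> < d)
      \<longrightarrow> \<bar>cos (s l j + c) - cos (t l j + c)\<bar> < e"
    using \<open>e > 0\<close> by (intro exI[of _ e]) blast
qed

lemma angular_add:
  assumes g: "angular L g" and h: "angular L h"
  shows "angular L (\<lambda>t. g t + h t)"
  unfolding angular_def
proof (intro conjI allI impI)
  obtain B where B: "\<And>t. \<bar>g t\<bar> \<le> B" using angular_bounded[OF g] by blast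
  obtain C where C: "\<And>t. \<bar>h t\<bar> \<le> C" using angular_bounded[OF h] by blast
  have "\<bar>g t + h t\<bar> \<le> B + C" for t
    by (rule order_trans[OF abs_triangle_ineq add_mono[OF B C]])
  then show "\<exists>B. \<forall>t. \<bar>g t + h t\<bar> \<le> B" by blast
  fix e :: real assume e: "e > 0"
  obtain d1 where d1: "d1 > 0" "\<And>s t. (\<And>l j. l \<in> L \<Longrightarrow> \<exists>z::int. \<bar>s l j - t l j - 2 * pi * of_int z\<bar> < d1) \<Longrightarrow> \<bar>g s - g t\<bar> < e / 2"
    using angularD[OF g half_gt_zero[OF e]] by blast
  obtain d2 where d2: "d2 > 0" "\<And>s t. (\<And>l j. l \<in> L \<Longrightarrow> \<exists>z::int. \<bar>s l j - t l j - 2 * pi * of_int z\<bar> < d2) \<Longrightarrow> \<bar>h s - h t\<bar> < e / 2"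
    using angularD[OF h half_gt_zero[OF e]] by blast
  have "\<bar>g s + h s - (g t + h t)\<bar> < e"
    if close: "\<forall>l\<in>L. \<forall>j. \<exists>z::int. \<bar>s l j - t l j - 2 * pi * of_int z\<bar> < min d1 d2" for s t
  proof -
    have "\<bar>g s - g t\<bar> < e / 2" by (rule d1) (use close in fastforce)
    moreover have "\<bar>h s - h t\<bar> < e / 2" by (rule d2) (use close in fastforce)
    ultimately show ?thesis by linarith
  qed
  then show "\<exists>d>0. \<forall>s t. (\<forall>l\<in>L. \<forall>j. \<exists>z::int. \<bar>s l j - t l j - 2 * pi * of_int z\<bar> < d) \<longrightarrow> \<bar>g s + h s - (g t + h t)\<bar> < e"
    using d1(1) d2(1) by (intro exI[of _ "min d1 d2"]) auto
qed

lemma angular_mult: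
  assumes g: "angular L g" and h: "angular L h"
  shows "angular L (\<lambda>t. g t * h t)"
  unfolding angular_def
proof (intro conjI allI impI)
  obtain B where B: "B > 0" "\<And>t. \<bar>g t\<bar> \<le> B" using angular_bounded[OF g] by blast
  obtain C where C: "C > 0" "\<And>t. \<bar>h t\<bar> \<le> C" using angular_bounded[OF h] by blast
  have "\<bar>g t * h t\<bar> \<le> B * C" for t
    unfolding abs_mult using B C by (intro mult_mono) auto
  then show "\<exists>B. \<forall>t. \<bar>g t * h t\<bar> \<le> B" by blast
  fix e :: real assume e: "e > 0"
  have eC: "e / (2 * C) > 0" and eB: "e / (2 * B) > 0" using e B C by auto
  obtain d1 where d1: "d1 > 0" "\<And>s t. (\<And>l j. l \<in> L \<Longrightarrow> \<exists>z::int. \<bar>s l j - t l j - 2 * pi * of_int z\<bar> < d1) \<Longrightarrow> \<bar>g s - g t\<bar> < e / (2 * C)"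
    using angularD[OF g eC] by blast
  obtain d2 where d2: "d2 > 0" "\<And>s t. (\<And>l j. l \<in> L \<Longrightarrow> \<exists>z::int. \<bar>s l j - t l j - 2 * pi * of_int z\<bar> < d2) \<Longrightarrow> \<bar>h s - h t\<bar> < e / (2 * B)"
    using angularD[OF h eB] by blast
  have "\<bar>g s * h s - g t * h t\<bar> < e"
    if close: "\<forall>l\<in>L. \<forall>j. \<exists>z::int. \<bar>s l j - t l j - 2 * pi * of_int z\<bar> < min d1 d2" for s t
  proof -
    have 1: "\<bar>g s - g t\<bar> < e / (2 * C)" by (rule d1) (use close in fastforce)
    have 2: "\<bar>h s - h t\<bar> < e / (2 * B)" by (rule d2) (use close in fastforce)
    have "\<bar>g s * h s - g t * h t\<bar> = \<bar>(g s - g t) * h s + g t * (h s - h t)\<bar>"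
      by (simp add: algebra_simps)
    also have "\<dots> \<le> \<bar>g s - g t\<bar> * \<bar>h s\<bar> + \<bar>g t\<bar> * \<bar>h s - h t\<bar>"
      by (metis abs_mult abs_triangle_ineq)
    also have "\<dots> \<le> \<bar>g s - g t\<bar> * C + B * \<bar>h s - h t\<bar>"
      using B C by (intro add_mono mult_mono) auto
    also have "\<dots> < e / (2 * C) * C + B * (e / (2 * B))"
      using 1 2 B C by (intro add_strict_mono mult_strict_right_mono mult_strict_left_mono)
    also have "\<dots> = e" using B C by (simp add: field_simps)
    finally show ?thesis .
  qed
  then show "\<exists>d>0. \<forall>s t. (\<forall>l\<in>L. \<forall>j. \<exists>z::int. \<bar>s l j - t l j - 2 * pi * of_int z\<bar> < d) \<longrightarrow> \<bar>g s * h s - g t * h t\<bar> < e"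
    using d1(1) d2(1) by (intro exI[of _ "min d1 d2"]) auto
qed

lemma angular_const: "angular L (\<lambda>t. c)"
  unfolding angular_def by (auto intro: exI[of _ 1])

text \<open>A generator involves one frequency; sums and products use the union of two finite
  frequency sets.\<close>

lemma trig_algebra_angular:
  assumes "f \<in> trig_algebra"
  shows "\<exists>L h. finite L \<and> angular L h \<and> (\<forall>x. f x = h (\<lambda>l j. l * x $ j))"
  using assms
proof induction
  case (cos l j)
  show ?case using angular_cos[of l j 0] by (intro exI[of _ "{l}"] exI[of _ "\<lambda>t. cos (t l j + 0)"]) auto
next
  case (sin l j)
  have "sin y = cos (y + (- (pi / 2)))" for y :: real by (simp add: cos_diff)
  then show ?case using angular_cos[of l j "- (pi / 2)"]
    by (intro exI[of _ "{l}"] exI[of _ "\<lambda>t. cos (t l j + (- (pi / 2)))"]) auto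
next
  case (add f g)
  then obtain L h L' h' where "finite L" "angular L h" "\<forall>x. f x = h (\<lambda>l j. l * x $ j)"
    "finite L'" "angular L' h'" "\<forall>x. g x = h' (\<lambda>l j. l * x $ j)" by blast
  then show ?case
    by (intro exI[of _ "L \<union> L'"] exI[of _ "\<lambda>t. h t + h' t"] conjI angular_add) (auto elim: angular_mono)
next
  case (mult f g)
  then obtain L h L' h' where "finite L" "angular L h" "\<forall>x. f x = h (\<lambda>l j. l * x $ j)"
    "finite L'" "angular L' h'" "\<forall>x. g x = h' (\<lambda>l j. l * x $ j)" by blast
  then show ?case
    by (intro exI[of _ "L \<union> L'"] exI[of _ "\<lambda>t. h t * h' t"] conjI angular_mult) (auto elim: angular_mono)
next
  case (scale f c)
  then obtain L h where "finite L" "angular L h" "\<forall>x. f x = h (\<lambda>l j. l * x $ j)" by blast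
  then show ?case
    by (intro exI[of _ L] exI[of _ "\<lambda>t. c * h t"] conjI angular_mult angular_const) auto
qed

text \<open>Finitely many angles matter, so their neighbourhoods have a common refinement; the
  integer \<open>z = 0\<close> serves for each.\<close>

lemma continuous_on_angular:
  fixes h :: "(real \<Rightarrow> 'n::finite \<Rightarrow> real) \<Rightarrow> real"
  assumes h: "angular L h" and "finite L"
    and cont: "\<And>l j. continuous_on S (\<lambda>u. a u l j)"
  shows "continuous_on S (\<lambda>u. h (a u))"
  unfolding continuous_on_def
proof (intro ballI tendstoI)
  fix u and e :: real assume u: "u \<in> S" and "e > 0"
  obtain d where d: "d > 0" "\<And>s t. (\<And>l j. l \<in> L \<Longrightarrow> \<exists>z::int. \<bar>s l j - t l j - 2 * pi * of_int z\<bar> < d) \<Longrightarrow> \<bar>h s - h t\<bar> < e"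
    using angularD[OF h \<open>e > 0\<close>] by blast
  have "\<forall>\<^sub>F v in at u within S. \<forall>l\<in>L. \<forall>j\<in>UNIV. dist (a v l j) (a u l j) < d"
    using cont u d(1) \<open>finite L\<close>
    by (intro eventually_ball_finite ballI tendstoD) (auto simp: continuous_on_def)
  then show "\<forall>\<^sub>F v in at u within S. dist (h (a v)) (h (a u)) < e"
  proof eventually_elim
    case (elim v)
    show ?case unfolding dist_real_def
      by (rule d) (use elim in \<open>auto intro!: exI[of _ 0] simp: dist_real_def\<close>)
  qed
qed

subsection \<open>Density\<close>

lemma angular_perturbed_density:
  fixes h :: "'d::finite \<Rightarrow> (real \<Rightarrow> 'nu::finite \<Rightarrow> real) \<Rightarrow> real"
    and P :: "'d \<Rightarrow> real poly"
    and PP :: "'d \<Rightarrow> 'nu \<Rightarrow> real poly"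
    and y :: "real ^ 'd"
  assumes fin: "finite L" and h: "\<And>i. angular L (h i)"
    and P0: "\<And>i. coeff (P i) 0 = 0" and PP0: "\<And>i j. coeff (PP i j) 0 = 0"
    and indep: "Q_independent P" and e: "e > 0"
  obtains n :: nat where "n \<ge> 1"
    "\<And>i. \<exists>z::int. \<bar>poly (P i) (real n) + h i (\<lambda>l j. l * poly (PP i j) (real n)) - y $ i - of_int z\<bar> < e"
proof -
  obtain \<phi> :: "'d \<Rightarrow> real poly \<Rightarrow> real" where \<phi>:
    "\<And>i p q. \<phi> i (p + q) = \<phi> i p + \<phi> i q"
    "\<And>i j. \<phi> i (P j) = (if i = j then 1 else 0)"
    "\<And>i p. (\<And>k. coeff p k \<in> \<rat>) \<Longrightarrow> \<phi> i p = 0"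
    using Q_independent_dual[OF indep] by blast
  define \<psi> where "\<psi> = (\<lambda>(u :: real ^ 'd) p. \<Sum>m\<in>UNIV. u $ m * \<phi> m p)"
  have \<psi>_P: "\<psi> u (P i) = u $ i" for u i
    by (simp add: \<psi>_def \<phi>(2) if_distrib cong: if_cong)
  have \<psi>_rat: "\<psi> u p = 0" if "\<And>k. coeff p k \<in> \<rat>" for u p
    using that by (simp add: \<psi>_def \<phi>(3))
  interpret \<psi>: additive "\<psi> u" for u
    by unfold_locales (simp add: \<psi>_def \<phi>(1) distrib_left sum.distrib)
  \<comment> \<open>Additivity already yields homogeneity for integer scalars, which is all that
    integer relations require.\<close>
  have \<psi>_int: "\<psi> u (smult (of_int k) p) = of_int k * \<psi> u p" for u k p
  proof -
    have nat: "\<psi> u (smult (of_nat k) p) = of_nat k * \<psi> u p" for k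
      by (induction k) (simp_all add: smult_add_left \<psi>.add \<psi>.zero distrib_right)
    show ?thesis
      by (cases k rule: int_cases2) (simp_all add: nat \<psi>.minus)
  qed

  \<comment> \<open>These are the angles that \<open>\<psi> u\<close> predicts for
    \<open>l * poly (PP i j) n\<close>; the factor \<open>2 * pi\<close> translates between periods.
    A fixed point of \<open>T\<close> solves \<open>u $ i + h i (a i u) = y $ i\<close>.\<close>
  define a where "a = (\<lambda>i (u :: real ^ 'd) l j. 2 * pi * \<psi> u (smult (l / (2 * pi)) (PP i j)))"
  define T where "T = (\<lambda>u. \<chi> i. y $ i - h i (a i u))"
  obtain B where B: "\<And>i t. \<bar>h i t\<bar> \<le> B i"
    using angular_bounded[OF h] by metis
  define S where "S = cbox (\<chi> i. y $ i - B i) (\<chi> i. y $ i + B i)"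
  have T_in: "T u \<in> S" for u
    unfolding S_def T_def mem_box_cart using B[of _ "a _ u"] by (auto simp: abs_le_iff)
  \<comment> \<open>For a fixed polynomial, \<open>\<psi> u\<close> is linear in the real vector
    \<open>u\<close>, although it is not real-linear in the polynomial.\<close>
  have "continuous_on S T"
    unfolding T_def a_def \<psi>_def
    by (intro continuous_on_vec_lambda continuous_intros continuous_on_angular[OF h fin])
  moreover have "compact S" "convex S" "S \<noteq> {}" "T \<in> S \<rightarrow> S"
    using T_in unfolding S_def by (auto simp: compact_cbox)
  ultimately obtain u where u: "T u = u"
    using brouwer[of S T] by blast

  have "\<forall>i. \<exists>d>0. \<forall>s t. (\<forall>l\<in>L. \<forall>j. \<exists>z::int. \<bar>s l j - t l j - 2 * pi * of_int z\<bar> < d) \<longrightarrow> \<bar>h i s - h i t\<bar> < e / 2"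
    using h half_gt_zero[OF e] unfolding angular_def by blast
  then obtain d where d: "\<forall>i. d i > 0 \<and> (\<forall>s t. (\<forall>l\<in>L. \<forall>j. \<exists>z::int. \<bar>s l j - t l j - 2 * pi * of_int z\<bar> < d i) \<longrightarrow> \<bar>h i s - h i t\<bar> < e / 2)"
    by (rule choice[THEN exE])
  \<comment> \<open>An error \<open>\<delta>\<close> modulo 1 becomes an angular error
    \<open>2 * pi * \<delta> \<le> d i\<close>, moving each \<open>h i\<close> by less than
    \<open>e / 2\<close>; the other half of \<open>e\<close> is for \<open>P i\<close>.\<close>
  define \<delta> where "\<delta> = min (e / 2) (Min (range d) / (2 * pi))"
  have "Min (range d) > 0" using d by simp
  then have \<delta>: "\<delta> > 0" "\<delta> \<le> e / 2" using e by (auto simp: \<delta>_def)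
  have \<delta>_d: "2 * pi * \<delta> \<le> d i" for i
  proof -
    have "\<delta> \<le> Min (range d) / (2 * pi)" by (simp add: \<delta>_def)
    then have "2 * pi * \<delta> \<le> Min (range d)" by (simp add: field_simps)
    then show ?thesis by (rule order_trans) simp
  qed

  define I :: "('d + real \<times> 'nu \<times> 'd) set" where "I = UNIV <+> (L \<times> UNIV)"
  define W where "W = case_sum P (\<lambda>(l, j, i). smult (l / (2 * pi)) (PP i j))"
  have "finite I" unfolding I_def using fin by simp
  then obtain n :: nat where n: "n \<ge> 1"
    "\<And>v. v \<in> I \<Longrightarrow> \<exists>z::int. \<bar>poly (W v) (real n) - \<psi> u (W v) - of_int z\<bar> < \<delta>"
  proof (rule polynomial_Kronecker[where W = W and w = "\<lambda>v. \<psi> u (W v)"])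
    show "coeff (W v) 0 = 0" for v
      by (auto simp: W_def P0 PP0 split: sum.split)
    \<comment> \<open>The sum is \<open>\<psi> u\<close> of a rational polynomial, hence 0.\<close>
    show "(\<Sum>v\<in>I. of_int (k v) * \<psi> u (W v)) \<in> \<int>"
      if "\<And>j. coeff (\<Sum>v\<in>I. smult (of_int (k v)) (W v)) j \<in> \<rat>" for k
      using \<psi>_rat[OF that, of u] by (simp add: \<psi>.sum \<psi>_int)
  qed (use \<delta> in auto)
  have "\<exists>z::int. \<bar>poly (P i) (real n) + h i (\<lambda>l j. l * poly (PP i j) (real n)) - y $ i - of_int z\<bar> < e" for i
  proof -
    obtain z :: int where z: "\<bar>poly (P i) (real n) - u $ i - of_int z\<bar> < \<delta>"
      using n(2)[of "Inl i"] by (auto simp: I_def W_def \<psi>_P)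
    have "\<bar>h i (\<lambda>l j. l * poly (PP i j) (real n)) - h i (a i u)\<bar> < e / 2"
    proof (rule d[THEN spec, THEN conjunct2, rule_format])
      fix l j assume "l \<in> L"
      then obtain z :: int where "\<bar>l / (2 * pi) * poly (PP i j) (real n) - \<psi> u (smult (l / (2 * pi)) (PP i j)) - of_int z\<bar> < \<delta>"
        using n(2)[of "Inr (l, j, i)"] by (auto simp: I_def W_def)
      then have "2 * pi * \<bar>l / (2 * pi) * poly (PP i j) (real n) - \<psi> u (smult (l / (2 * pi)) (PP i j)) - of_int z\<bar> < d i"
        using \<delta>_d[of i] by (intro order_less_le_trans[OF mult_strict_left_mono]) auto
      also have "2 * pi * \<bar>l / (2 * pi) * poly (PP i j) (real n) - \<psi> u (smult (l / (2 * pi)) (PP i j)) - of_int z\<bar>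
          = \<bar>2 * pi * (l / (2 * pi) * poly (PP i j) (real n) - \<psi> u (smult (l / (2 * pi)) (PP i j)) - of_int z)\<bar>"
        by (simp add: abs_mult)
      also have "2 * pi * (l / (2 * pi) * poly (PP i j) (real n) - \<psi> u (smult (l / (2 * pi)) (PP i j)) - of_int z)
          = l * poly (PP i j) (real n) - a i u l j - 2 * pi * of_int z"
        by (simp add: a_def field_simps)
      finally show "\<exists>z::int. \<bar>l * poly (PP i j) (real n) - a i u l j - 2 * pi * of_int z\<bar> < d i" ..
    qed
    moreover have "u $ i = y $ i - h i (a i u)"
      using arg_cong[OF u, of "\<lambda>v. v $ i"] by (simp add: T_def)
    ultimately have "\<bar>poly (P i) (real n) + h i (\<lambda>l j. l * poly (PP i j) (real n)) - y $ i - of_int z\<bar> < e"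
      using z \<delta>(2) by linarith
    then show ?thesis ..
  qed
  then show ?thesis using that n(1) by blast
qed

lemma dense_mod1I:
  fixes a :: "nat \<Rightarrow> real ^ 'd::finite"
  assumes approx: "\<And>y e. e > 0 \<Longrightarrow> \<exists>n\<ge>1. \<forall>i. \<exists>z::int. \<bar>a n $ i - y $ i - of_int z\<bar> < e"
  shows "dense_mod1 a"
  unfolding dense_mod1_def
proof
  fix x :: "real ^ 'd" assume "x \<in> {x. \<forall>i. 0 \<le> x $ i \<and> x $ i < 1}"
  then have x: "\<And>i. 0 \<le> x $ i" "\<And>i. x $ i < 1" by auto
  show "x \<in> closure ((\<lambda>n. \<chi> i. frac (a n $ i)) ` {1..})"
    unfolding closure_approachable
  proof (intro allI impI)
    fix e :: real assume e: "e > 0"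
    \<comment> \<open>Each coordinate will be off by less than \<open>2 * c\<close>, and the
      \<open>l1\<close> norm adds up \<open>CARD('d)\<close> of them.\<close>
    define c where "c = e / (2 * CARD('d))"
    have c: "c > 0" using e by (simp add: c_def)
    define \<eta> where "\<eta> = min c (1 / 2)"
    \<comment> \<open>Moving the target off \<open>0\<close> avoids the jump of \<open>frac\<close> at the integers.\<close>
    define y :: "real ^ 'd" where "y = (\<chi> i. max (x $ i) \<eta>)"
    have y: "0 < y $ i" "y $ i < 1" "\<bar>y $ i - x $ i\<bar> \<le> c" for i
      using x[of i] c by (auto simp: y_def \<eta>_def)
    \<comment> \<open>With \<open>d\<close> at most the distance from \<open>y $ i\<close> to 0 and
      to 1, the number \<open>a n $ i - z\<close> lies in \<open>(0, 1)\<close> and so is the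
      fractional part.\<close>
    define d where "d = Min (insert c (range (\<lambda>i. min (y $ i) (1 - y $ i))))"
    have d: "d > 0" "d \<le> c" "\<And>i. d \<le> y $ i" "\<And>i. d \<le> 1 - y $ i"
    proof -
      show "d > 0" using y c by (auto simp: d_def)
      have "d \<le> min (y $ i) (1 - y $ i)" for i unfolding d_def by (intro Min_le) auto
      then show "d \<le> y $ i" "d \<le> 1 - y $ i" for i by simp_all
      show "d \<le> c" unfolding d_def by (intro Min_le) auto
    qed
    obtain n where n: "n \<ge> 1" "\<And>i. \<exists>z::int. \<bar>a n $ i - y $ i - of_int z\<bar> < d"
      using approx[OF d(1)] by blast
    have "\<bar>frac (a n $ i) - x $ i\<bar> < 2 * c" for i
    proof -
      obtain z :: int where z: "\<bar>a n $ i - y $ i - of_int z\<bar> < d" using n(2) by blast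
      have "frac (a n $ i) = a n $ i - of_int z"
        unfolding frac_unique_iff using z d(3,4)[of i] by auto
      then show ?thesis using z d(2) y(3)[of i] by linarith
    qed
    then have "(\<Sum>i\<in>UNIV. \<bar>((\<chi> i. frac (a n $ i)) - x) $ i\<bar>) < (\<Sum>i\<in>(UNIV::'d set). 2 * c)"
      by (intro sum_strict_mono) auto
    also have "(\<Sum>i\<in>(UNIV::'d set). 2 * c) = e" by (simp add: c_def)
    finally have "dist (\<chi> i. frac (a n $ i)) x < e"
      unfolding dist_norm using norm_le_l1_cart order_le_less_trans by blast
    then show "\<exists>v\<in>(\<lambda>n. \<chi> i. frac (a n $ i)) ` {1..}. dist v x < e" using n(1) by auto
  qed
qed

theorem theorem3p7:
  fixes F :: "'d::finite \<Rightarrow> real ^ 'nu::finite \<Rightarrow> real"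
    and P :: "'d \<Rightarrow> real poly"
    and PP :: "'d \<Rightarrow> 'nu \<Rightarrow> real poly"
  assumes "\<And>i. almost_periodic (F i)"
    and "\<And>i. coeff (P i) 0 = 0"
    and "\<And>i j. coeff (PP i j) 0 = 0"
    and "Q_independent P"
  shows "dense_mod1 (\<lambda>n. \<chi> i. poly (P i) (real n) + F i (\<chi> j. poly (PP i j) (real n)))"
proof (rule dense_mod1I)
  fix y :: "real ^ 'd" and e :: real assume e: "e > 0"
  have "\<exists>L h. finite L \<and> angular L h \<and> (\<forall>x. \<bar>F i x - h (\<lambda>l j. l * x $ j)\<bar> < e / 2)" for i
  proof -
    obtain f where "f \<in> trig_algebra" "\<forall>x. \<bar>F i x - f x\<bar> < e / 2"
      using assms(1)[of i] e unfolding almost_periodic_def by (meson half_gt_zero)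
    then show ?thesis using trig_algebra_angular[of f] by metis
  qed
  then obtain L h where L: "\<And>i. finite (L i)" and h: "\<And>i. angular (L i) (h i)"
    and F: "\<And>i x. \<bar>F i x - h i (\<lambda>l j. l * x $ j)\<bar> < e / 2"
    by metis
  \<comment> \<open>One finite frequency set is needed for all coordinates simultaneously.\<close>
  have "angular (\<Union>i. L i) (h i)" for i using h by (rule angular_mono) auto
  moreover have "finite (\<Union>i. L i)" using L by simp
  ultimately obtain n :: nat where n: "n \<ge> 1"
    "\<And>i. \<exists>z::int. \<bar>poly (P i) (real n) + h i (\<lambda>l j. l * poly (PP i j) (real n)) - y $ i - of_int z\<bar> < e / 2"
    using angular_perturbed_density[of "\<Union>i. L i" h P PP "e / 2" y] assms e by (metis half_gt_zero)
  have "\<exists>z::int. \<bar>poly (P i) (real n) + F i (\<chi> j. poly (PP i j) (real n)) - y $ i - of_int z\<bar> < e" for i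
  proof -
    obtain z :: int where "\<bar>poly (P i) (real n) + h i (\<lambda>l j. l * poly (PP i j) (real n)) - y $ i - of_int z\<bar> < e / 2"
      using n(2) by blast
    then have "\<bar>poly (P i) (real n) + F i (\<chi> j. poly (PP i j) (real n)) - y $ i - of_int z\<bar> < e"
      using F[of i "\<chi> j. poly (PP i j) (real n)"] unfolding vec_lambda_beta by linarith
    then show ?thesis ..
  qed
  then show "\<exists>n\<ge>1. \<forall>i. \<exists>z::int. \<bar>(\<chi> i. poly (P i) (real n) + F i (\<chi> j. poly (PP i j) (real n))) $ i - y $ i - of_int z\<bar> < e"
    using n(1) by auto
qed

end
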